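(* Let $p$ be an odd prime, let $0<\alpha<1$, and let $c>0$ be a constant such that for every non-principal Dirichlet character $\chi$ modulo $p$ and all integers $N\ge 0$ and $1\le H<p$, $$\left|\sum_{m=N+1}^{N+H}\chi(m)\right| \le c\sqrt{p}\,\log p.$$ Let $n=\omega(p-1)$. Let $e$ be an even divisor of $p-1$ and let $p_1,\dots,p_s$ be the primes dividing $p-1$ but not dividing $e$, where $1\le s\le n$. Define $$\delta = 1-\sum_{i=1}^{s}\frac{1}{p_i},\qquad \Delta=\frac{s-1}{\delta}+2,$$ and suppose $\delta>0$. If $$\frac{p^{\alpha-1/2}}{\log p} > c\left(2^{\,n-s}\Delta-1\right),$$ then there is a primitive root $g$ modulo $p$ with $g<p^{\alpha}$.
   Context: $\omega(m)$ denotes the number of distinct prime divisors of a positive integer $m$. A primitive root modulo $p$ is an integer whose residue generates the multiplicative group $(\mathbb{Z}/p\mathbb{Z})^\times$. *)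

theory Defs
  imports "HOL-Analysis.Analysis" "HOL-Number_Theory.Number_Theory"
begin

definition dirichlet_character :: "nat \<Rightarrow> (nat \<Rightarrow> complex) \<Rightarrow> bool" where
  "dirichlet_character m chi \<longleftrightarrow>
     (\<forall>a b. chi (a * b) = chi a * chi b) \<and>
     (\<forall>a. chi (a + m) = chi a) \<and>
     (\<forall>a. chi a = 0 \<longleftrightarrow> \<not> coprime a m)"

definition principal_character :: "nat \<Rightarrow> (nat \<Rightarrow> complex) \<Rightarrow> bool" where
  "principal_character m chi \<longleftrightarrow> (\<forall>a. coprime a m \<longrightarrow> chi a = 1)"

definition omega :: "nat \<Rightarrow> nat" where
  "omega n = card (prime_factors n)"

end

theory Submission
  imports Defs
begin

text \<open>
  Fix a primitive root and call \<open>m\<close> free of a prime \<open>q\<close> dividing \<open>p - 1\<close> if \<open>q\<close> does not divide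
  the index of \<open>m\<close>; primitive roots are the \<open>m\<close> free of all such \<open>q\<close>. The indicator of freeness is
  \<open>1 - 1/q\<close> plus a combination of the nontrivial characters of order \<open>q\<close>, so products of
  indicators expand into characters, whose sums over \<open>{1..H}\<close> are at most
  \<open>C = c * sqrt p * ln p\<close>. Sieving by the primes not dividing \<open>e\<close> (a product of indicators is at least
  one minus the sum of their complements) shows that \<open>{1..H}\<close> contains a primitive root
  as soon as \<open>H > C * (2 ^ (n - s) * \<Delta> - 1)\<close>.

  The hypothesis gives this inequality only for \<open>p powr \<alpha>\<close>, which exceeds the largest admissible
  integer \<open>H\<close> by up to one. The loss is recovered from the characters of odd order: they are even, so
  their sums over \<open>{1..H}\<close> are bounded by \<open>C / 2\<close>, and for \<open>H = 1\<close> this also shows \<open>C \<ge> 2\<close>.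
\<close>

section \<open>Dirichlet characters as periodic functions and their sums over a period\<close>

lemma dirichlet_character_cong:
  assumes "dirichlet_character m chi" "[a = b] (mod m)"
  shows   "chi a = chi b"
proof -
  have shift: "chi (a + k * m) = chi a" for a k
  proof (induction k)
    case (Suc k)
    have "chi (a + Suc k * m) = chi ((a + k * m) + m)"
      by (simp add: algebra_simps)
    then show ?case
      using assms(1) Suc by (simp add: dirichlet_character_def)
  qed auto
  have "chi a = chi (a mod m)" for a
    using shift[of "a mod m" "a div m"] by simp
  then show ?thesis
    using assms(2) unfolding cong_def by metis
qed

lemma dirichlet_character_1:
  assumes "dirichlet_character m chi"
  shows   "chi 1 = 1"
proof -
  have "chi (1 * 1) = chi 1 * chi 1" "chi 1 \<noteq> 0"
    using assms unfolding dirichlet_character_def by (blast, simp)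
  then show ?thesis by simp
qed

lemma dirichlet_character_0:
  assumes "dirichlet_character m chi" "m > 1"
  shows   "chi 0 = 0"
  using assms by (simp add: dirichlet_character_def)

text \<open>Multiplication by a unit \<open>a\<close> with \<open>chi a \<noteq> 1\<close> permutes
  the residues, so the sum equals \<open>chi a\<close> times itself.\<close>

lemma sum_nonprincipal_character_eq_0:
  assumes chi: "dirichlet_character m chi" and np: "\<not> principal_character m chi"
    and "m > 0"
  shows   "(\<Sum>k<m. chi k) = 0"
proof -
  obtain a where a: "coprime a m" "chi a \<noteq> 1"
    using np by (auto simp: principal_character_def)
  have inj: "inj_on (\<lambda>k. a * k mod m) {..<m}"
  proof (rule inj_onI)
    fix x y assume xy: "x \<in> {..<m}" "y \<in> {..<m}" "a * x mod m = a * y mod m"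
    then have "[a * x = a * y] (mod m)" by (simp add: cong_def)
    then have "[x = y] (mod m)" using a(1) cong_mult_lcancel_nat by blast
    then show "x = y" using xy cong_less_modulus_unique_nat by auto
  qed
  have "(\<lambda>k. a * k mod m) ` {..<m} = {..<m}"
    using \<open>m > 0\<close> by (intro endo_inj_surj inj) auto
  then have "(\<Sum>k<m. chi k) = (\<Sum>k\<in>(\<lambda>k. a * k mod m) ` {..<m}. chi k)" by simp
  also have "\<dots> = (\<Sum>k<m. chi (a * k mod m))"
    using sum.reindex[OF inj] by simp
  also have "\<dots> = (\<Sum>k<m. chi (a * k))"
    by (intro sum.cong refl dirichlet_character_cong[OF chi]) (auto simp: cong_def)
  also have "\<dots> = chi a * (\<Sum>k<m. chi k)"
    using chi by (simp add: dirichlet_character_def sum_distrib_left)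
  finally show ?thesis using a(2) by (simp add: mult_cancel_right2)
qed

section \<open>Halved bounds for sums of even characters\<close>

text \<open>Modulo \<open>m\<close>, the factor \<open>m - 1\<close> is -1, so \<open>m - k\<close>
  is congruent to \<open>(m - 1) * k\<close>; evenness is the condition
  \<open>chi (m - 1) = 1\<close>.\<close>

lemma even_character_reflect:
  assumes chi: "dirichlet_character m chi" and even: "chi (m - 1) = 1" and "k \<le> m" "m > 0"
  shows   "chi (m - k) = chi k"
proof -
  have "int (m - k) - int ((m - 1) * k) = int m * (1 - int k)"
    using assms by (simp add: of_nat_diff algebra_simps)
  then have "[m - k = (m - 1) * k] (mod m)"
    by (metis cong_iff_dvd_diff cong_int_iff dvd_triv_left)
  then have "chi (m - k) = chi ((m - 1) * k)"
    by (rule dirichlet_character_cong[OF chi])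
  then show ?thesis
    using chi even by (simp add: dirichlet_character_def)
qed

lemma even_character_sum_tail:
  assumes "dirichlet_character m chi" "chi (m - 1) = 1" "h < m"
  shows   "(\<Sum>k = m - h..<m. chi k) = (\<Sum>k = 1..h. chi k)"
  using assms
  by (intro sum.reindex_bij_witness[of _ "\<lambda>k. m - k" "\<lambda>k. m - k"])
     (auto simp: even_character_reflect)

text \<open>The values on the two halves of a symmetric interval agree and the sum over a full period
  vanishes, which reduces to a sum over a symmetric interval of length less than \<open>m\<close>.\<close>

lemma even_character_sum_bound:
  assumes chi: "dirichlet_character m chi" and np: "\<not> principal_character m chi"
    and even: "chi (m - 1) = 1"
    and bound: "\<And>N H. 1 \<le> H \<Longrightarrow> H < m \<Longrightarrow> norm (\<Sum>k = N + 1..N + H. chi k) \<le> C"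
    and "1 < m" "h < m"
  shows   "norm (\<Sum>k = 1..h. chi k) \<le> C / 2"
proof -
  have total: "(\<Sum>k = 1..<m. chi k) = 0"
  proof -
    have "(\<Sum>k<m. chi k) = chi 0 + (\<Sum>k = 1..<m. chi k)"
      using \<open>1 < m\<close> by (simp add: lessThan_atLeast0 sum.atLeast_Suc_lessThan)
    then show ?thesis
      using sum_nonprincipal_character_eq_0[OF chi np] dirichlet_character_0[OF chi] \<open>1 < m\<close>
      by simp
  qed
  have C0: "0 \<le> C"
    using bound[of 1 0] norm_ge_zero order_trans \<open>1 < m\<close> by blast
  have lower: "norm (\<Sum>k = 1..h. chi k) \<le> C / 2" if h: "2 * h \<le> m - 1" for h
  proof -
    have "(\<Sum>k = 1..<m. chi k) = (\<Sum>k = 1..<h+1. chi k) + (\<Sum>k = h+1..<m-h. chi k)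
            + (\<Sum>k = m-h..<m. chi k)"
      using h \<open>1 < m\<close> by (subst sum.atLeastLessThan_concat, simp, linarith,
          subst sum.atLeastLessThan_concat) auto
    moreover have "(\<Sum>k = m-h..<m. chi k) = (\<Sum>k = 1..h. chi k)"
      using h \<open>1 < m\<close> by (intro even_character_sum_tail chi even) linarith
    moreover have "(\<Sum>k = 1..<h+1. chi k) = (\<Sum>k = 1..h. chi k)"
      by (intro sum.cong) auto
    moreover have "b + 2 * a = a + b + a" for a b :: complex by simp
    ultimately have "(\<Sum>k = h+1..<m-h. chi k) + 2 * (\<Sum>k = 1..h. chi k) = 0"
      using total by metis
    then have eq: "(\<Sum>k = h+1..<m-h. chi k) = - (2 * (\<Sum>k = 1..h. chi k))"
      by (simp only: eq_neg_iff_add_eq_0)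
    have "norm (\<Sum>k = h+1..<m-h. chi k) \<le> C"
    \<comment> \<open>The middle block has length \<open>m - 1 - 2 * h\<close>. If it is empty,
      \<open>bound\<close>, which starts at length one, does not apply and \<open>C0\<close> takes
      its place.\<close>
    proof (cases "2 * h = m - 1")
      case True
      then have "{h+1..<m-h} = {}" by auto
      then show ?thesis using C0 by simp
    next
      case False
      with h have "{h+1..<m-h} = {h+1..h+(m-1-2*h)}" "1 \<le> m-1-2*h" by auto
      then show ?thesis
        using bound[of "m-1-2*h" h] \<open>1 < m\<close> by simp
    qed
    then show ?thesis unfolding eq by (simp add: norm_mult)
  qed
  show ?thesis
  proof (cases "2 * h \<le> m - 1")
    \<comment> \<open>Beyond the midpoint, the terms after \<open>h\<close> reflect to an initial
      segment of length \<open>m - 1 - h\<close>, which is short enough for \<open>lower\<close>,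
      and the vanishing total makes the two sums opposite.\<close>
    case False
    have "(\<Sum>k = 1..<m. chi k) = (\<Sum>k = 1..<h+1. chi k) + (\<Sum>k = m-(m-1-h)..<m. chi k)"
      using \<open>h < m\<close> by (subst sum.atLeastLessThan_concat[symmetric, of _ "h+1"]) auto
    also have "(\<Sum>k = m-(m-1-h)..<m. chi k) = (\<Sum>k = 1..m-1-h. chi k)"
      using \<open>h < m\<close> by (intro even_character_sum_tail chi even) linarith
    also have "{1..<h+1} = {1..h}" by auto
    finally have "(\<Sum>k = 1..h. chi k) = - (\<Sum>k = 1..m-1-h. chi k)"
      using total by (simp add: eq_neg_iff_add_eq_0)
    then have "norm (\<Sum>k = 1..h. chi k) = norm (\<Sum>k = 1..m-1-h. chi k)"
      by simp
    also have "\<dots> \<le> C / 2"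
      by (rule lower) (use False in linarith)
    finally show ?thesis .
  qed (rule lower)
qed

section \<open>The index to a primitive root and the characters built from it\<close>

lemma cis_root_power_eq_1_iff:
  assumes "q > 0"
  shows   "cis (2 * pi / real q) ^ k = 1 \<longleftrightarrow> q dvd k"
proof
  assume "cis (2 * pi / real q) ^ k = 1"
  then have "cos (real k * (2 * pi / real q)) = 1"
    unfolding Complex.DeMoivre by (metis cis.sel(1) one_complex.sel(1))
  then obtain x :: int where "real k * (2 * pi / real q) = of_int x * 2 * pi"
    unfolding cos_one_2pi_int by blast
  then have "real k = of_int x * real q"
    using assms by (simp add: field_simps)
  then have "real_of_int (int k) = real_of_int (x * int q)" by simp
  then have "int k = x * int q" unfolding of_int_eq_iff .
  then show "q dvd k" by (metis dvd_triv_right int_dvd_int_iff)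
next
  assume "q dvd k"
  then obtain l where "k = q * l" by auto
  moreover have "cis (2 * pi / real q) ^ q = 1"
    using assms by (simp add: Complex.DeMoivre)
  ultimately show "cis (2 * pi / real q) ^ k = 1"
    by (simp add: power_mult)
qed

text \<open>The discrete logarithm to base \<open>g\<close>. For a primitive root \<open>g\<close>
  and \<open>m\<close> coprime to \<open>p\<close> it is determined modulo \<open>p - 1\<close>, so
  its divisibility by a divisor of \<open>p - 1\<close> does not depend on the choice made.\<close>

definition primroot_index :: "nat \<Rightarrow> nat \<Rightarrow> nat \<Rightarrow> nat" where
  "primroot_index p g m = (SOME k. [g ^ k = m] (mod p))"

text \<open>For \<open>q\<close> dividing \<open>p - 1\<close>, this is the \<open>j\<close>-th
  power of the character of order \<open>q\<close> that sends \<open>g\<close> to the first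
  \<open>q\<close>-th root of unity.\<close>

definition power_residue_character :: "nat \<Rightarrow> nat \<Rightarrow> nat \<Rightarrow> nat \<Rightarrow> nat \<Rightarrow> complex" where
  "power_residue_character p g q j m =
     (if coprime m p then cis (2 * pi / real q) ^ (j * primroot_index p g m) else 0)"

definition index_free :: "nat \<Rightarrow> nat \<Rightarrow> nat \<Rightarrow> nat \<Rightarrow> real" where
  "index_free p g q m = of_bool (\<not> q dvd primroot_index p g m)"

text \<open>The oscillating part of \<open>index_free\<close>: its expansion into characters of
  order dividing \<open>q\<close>, without the term \<open>j = 0\<close> that produces the mean
  \<open>1 - 1 / q\<close>.\<close>

definition index_free_osc :: "nat \<Rightarrow> nat \<Rightarrow> nat \<Rightarrow> nat \<Rightarrow> complex" where
  "index_free_osc p g q m = (\<Sum>j = 1..<q. - (1 / of_nat q) * power_residue_character p g q j m)"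

locale prime_primroot =
  fixes p g :: nat
  assumes prime_p: "prime p" and primroot_g: "residue_primroot p g"
begin

abbreviation "ind \<equiv> primroot_index p g"
abbreviation "prc \<equiv> power_residue_character p g"

lemma p_gt_1: "p > 1"
  using prime_p prime_gt_1_nat by blast

lemma coprime_g: "coprime p g"
  using primroot_g by (simp add: residue_primroot_def)

lemma ord_g: "ord p g = p - 1"
  using primroot_g prime_p by (simp add: residue_primroot_def totient_prime)

lemma coprime_less: "1 \<le> m \<Longrightarrow> m < p \<Longrightarrow> coprime m p"
  using prime_imp_coprime[OF prime_p, of m] nat_dvd_not_less[of m p] by (simp add: coprime_commute)

lemma index_power_cong:
  assumes "coprime m p"
  shows   "[g ^ ind m = m] (mod p)"
proof -
  have "bij_betw (\<lambda>i. g ^ i mod p) {..<totient p} (totatives p)"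
    using residue_primroot_is_generator p_gt_1 primroot_g by blast
  moreover have "m mod p \<in> totatives p"
    using assms p_gt_1 by (auto simp: totatives_def coprime_commute intro!: Nat.gr0I)
  ultimately obtain k where "g ^ k mod p = m mod p"
    by (metis (no_types, lifting) bij_betw_imp_surj_on imageE)
  then have "\<exists>k. [g ^ k = m] (mod p)"
    by (auto simp: cong_def)
  then show ?thesis
    unfolding primroot_index_def by (rule someI_ex)
qed

lemma index_cong: "[a = b] (mod p) \<Longrightarrow> ind a = ind b"
  by (simp add: primroot_index_def cong_def)

text \<open>Exponents giving the same power of \<open>g\<close> agree modulo its order
  \<open>p - 1\<close>.\<close>

lemma index_eqI:
  assumes "coprime m p" "[g ^ k = m] (mod p)"
  shows   "[ind m = k] (mod (p - 1))"
proof -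
  have "[g ^ ind m = g ^ k] (mod p)"
    using index_power_cong[OF assms(1)] assms(2) cong_sym cong_trans by blast
  then show ?thesis
    using order_divides_expdiff[OF coprime_g] ord_g by simp
qed

lemma index_mult:
  assumes "coprime a p" "coprime b p"
  shows   "[ind (a * b) = ind a + ind b] (mod (p - 1))"
  using assms
  by (intro index_eqI) (simp_all add: power_add cong_mult index_power_cong)

text \<open>The order of \<open>g ^ ind m\<close> is \<open>p - 1\<close> divided by its gcd with
  \<open>ind m\<close>.\<close>

lemma residue_primroot_if_index_coprime:
  assumes "coprime m p" "coprime (ind m) (p - 1)"
  shows   "residue_primroot p m"
proof -
  have "ord p (g ^ ind m) = p - 1"
    using assms(2) by (simp add: ord_power[OF coprime_g] ord_g)
  then have "residue_primroot p (g ^ ind m)"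
    using coprime_g p_gt_1 prime_p by (simp add: residue_primroot_def totient_prime)
  then show ?thesis
    using residue_primroot_cong[OF index_power_cong[OF assms(1)]] by simp
qed

text \<open>Powers of a \<open>q\<close>-th root of unity see the exponent only modulo
  \<open>q\<close>, and \<open>q\<close> divides \<open>p - 1\<close>; this removes the ambiguity of
  the index.\<close>

lemma power_residue_character_cong_exp:
  assumes "q dvd p - 1" "[k = l] (mod (p - 1))"
  shows   "cis (2 * pi / real q) ^ (j * k) = cis (2 * pi / real q) ^ (j * l)"
proof -
  have q: "q > 0"
    using assms p_gt_1 by (intro Nat.gr0I) auto
  have red: "cis (2 * pi / real q) ^ (j * k) = cis (2 * pi / real q) ^ (j * (k mod q))" for k
  proof -
    have "cis (2 * pi / real q) ^ (q * (j * (k div q))) = 1"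
      using q by (subst cis_root_power_eq_1_iff) auto
    moreover have "j * k = q * (j * (k div q)) + j * (k mod q)"
      by (metis distrib_left mult.left_commute mult_div_mod_eq)
    ultimately show ?thesis by (metis mult_1 power_add)
  qed
  have "k mod q = l mod q"
    using cong_dvd_modulus_nat[OF assms(2) assms(1)] by (simp add: cong_def)
  then show ?thesis using red by metis
qed

lemma power_residue_character_is_character:
  assumes "q dvd p - 1"
  shows   "dirichlet_character p (prc q j)"
  unfolding dirichlet_character_def
proof (intro conjI allI)
  fix a b
  show "prc q j (a * b) = prc q j a * prc q j b"
  proof (cases "coprime a p \<and> coprime b p")
    case True
    then have "prc q j (a * b) = cis (2 * pi / real q) ^ (j * (ind a + ind b))"
      using power_residue_character_cong_exp[OF assms index_mult]
      by (simp add: power_residue_character_def)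
    then show ?thesis
      using True by (simp add: power_residue_character_def distrib_left power_add)
  qed (auto simp: power_residue_character_def)
  have "coprime (a + p) p \<longleftrightarrow> coprime a p"
    unfolding coprime_iff_gcd_eq_1 gcd_add1 ..
  then show "prc q j (a + p) = prc q j a"
    using index_cong[of "a + p" a] by (simp add: power_residue_character_def cong_def)
  show "prc q j a = 0 \<longleftrightarrow> \<not> coprime a p"
    by (simp add: power_residue_character_def)
qed

text \<open>The value at -1 has square 1 and \<open>q\<close>-th power 1, and \<open>q\<close> is
  odd. Hence characters of odd order are even.\<close>

lemma power_residue_character_minus_1:
  assumes "q dvd p - 1" "odd q" "q > 0"
  shows   "prc q j (p - 1) = 1"
proof -
  let ?x = "prc q j (p - 1)"
  note chr = power_residue_character_is_character[OF assms(1), of j]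
  have cop: "coprime (p - 1) p" using p_gt_1 by (intro coprime_less) auto
  have "int (p - 1) = int p - 1" using p_gt_1 by simp
  then have "int ((p - 1) * (p - 1)) - int 1 = int p * (int p - 2)"
    by (simp only: of_nat_mult) (simp add: algebra_simps)
  then have "[(p - 1) * (p - 1) = 1] (mod p)"
    by (metis cong_iff_dvd_diff cong_int_iff dvd_triv_left)
  then have "prc q j ((p - 1) * (p - 1)) = 1"
    using dirichlet_character_cong[OF chr] dirichlet_character_1[OF chr] by metis
  then have sq: "?x ^ 2 = 1"
    using chr by (simp add: dirichlet_character_def power2_eq_square)
  have "?x ^ q = 1"
    using assms cop by (simp add: power_residue_character_def power_mult[symmetric]
        cis_root_power_eq_1_iff)
  moreover obtain k where "q = 2 * k + 1" using \<open>odd q\<close> oddE by blast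
  ultimately show ?thesis
    using sq by (simp add: power_mult)
qed

text \<open>All three defining properties pass to products; \<open>T\<close> is nonempty because an
  empty product would not vanish at multiples of \<open>p\<close>.\<close>

lemma prod_power_residue_character_is_character:
  assumes "T \<noteq> {}" "finite T" "\<And>q. q \<in> T \<Longrightarrow> q dvd p - 1"
  shows   "dirichlet_character p (\<lambda>m. \<Prod>q\<in>T. prc q (J q) m)"
proof -
  have chr: "dirichlet_character p (prc q (J q))" if "q \<in> T" for q
    by (rule power_residue_character_is_character) (rule assms(3)[OF that])
  show ?thesis
    unfolding dirichlet_character_def
  proof (intro conjI allI)
    fix a b
    show "(\<Prod>q\<in>T. prc q (J q) (a * b)) = (\<Prod>q\<in>T. prc q (J q) a) * (\<Prod>q\<in>T. prc q (J q) b)"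
      unfolding prod.distrib[symmetric] using chr
      by (intro prod.cong refl) (simp add: dirichlet_character_def)
    show "(\<Prod>q\<in>T. prc q (J q) (a + p)) = (\<Prod>q\<in>T. prc q (J q) a)"
      using chr by (intro prod.cong refl) (simp add: dirichlet_character_def)
    have "prc q (J q) a = 0 \<longleftrightarrow> \<not> coprime a p" if "q \<in> T" for q
      using chr[OF that] by (simp add: dirichlet_character_def)
    then show "(\<Prod>q\<in>T. prc q (J q) a) = 0 \<longleftrightarrow> \<not> coprime a p"
      using assms(1,2) by auto
  qed
qed

text \<open>Pick \<open>r\<close> in \<open>T\<close> and let \<open>P\<close> be the product of the
  other primes. At \<open>g ^ P\<close> every factor with \<open>q \<noteq> r\<close> is 1, whereas
  the factor at \<open>r\<close> is not, since \<open>r\<close> divides neither \<open>J r\<close>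
  nor \<open>P\<close>.\<close>

lemma prod_power_residue_character_nonprincipal:
  assumes "T \<noteq> {}" "finite T" and T: "\<And>q. q \<in> T \<Longrightarrow> prime q \<and> q dvd p - 1"
    and J: "\<And>q. q \<in> T \<Longrightarrow> J q \<in> {1..<q}"
  shows   "\<not> principal_character p (\<lambda>m. \<Prod>q\<in>T. prc q (J q) m)"
proof -
  obtain r where r: "r \<in> T" using assms(1) by auto
  define P where "P = \<Prod>(T - {r})"
  have cop: "coprime (g ^ P) p"
    using coprime_g by (simp add: coprime_commute)
  have eval: "prc q (J q) (g ^ P) = cis (2 * pi / real q) ^ (J q * P)" if "q \<in> T" for q
    using power_residue_character_cong_exp[OF _ index_eqI[OF cop], of q P] T[OF that] cop
    by (simp add: power_residue_character_def)
  have "prc q (J q) (g ^ P) = 1" if "q \<in> T - {r}" for q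
  proof -
    have "q dvd P" unfolding P_def using that assms(2) by (intro dvd_prodI) auto
    then show ?thesis
      using eval[of q] that T[of q] prime_gt_0_nat[of q] by (simp add: cis_root_power_eq_1_iff)
  qed
  then have "(\<Prod>q\<in>T. prc q (J q) (g ^ P)) = prc r (J r) (g ^ P)"
    using r assms(2) by (simp add: prod.remove[of T r])
  moreover have "\<not> r dvd J r * P"
  proof -
    have "prime r" using T r by blast
    have "\<not> r dvd J r" using J[OF r] by (auto dest: dvd_imp_le)
    moreover have "\<not> r dvd P"
    proof
      assume "r dvd P"
      then obtain q where "q \<in> T - {r}" "r dvd q"
        using prime_dvd_prod_iff[of "T - {r}" r "\<lambda>x. x"] \<open>prime r\<close> assms(2) unfolding P_def by auto
      then show False using T[of q] \<open>prime r\<close> primes_dvd_imp_eq by auto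
    qed
    ultimately show ?thesis
      using \<open>prime r\<close> prime_dvd_mult_iff by blast
  qed
  then have "prc r (J r) (g ^ P) \<noteq> 1"
    using eval[OF r] T[OF r] prime_gt_0_nat[of r] by (simp add: cis_root_power_eq_1_iff)
  ultimately show ?thesis
    using cop unfolding principal_character_def by metis
qed

text \<open>Orthogonality: the geometric sum of the powers of \<open>x\<close> over
  \<open>j < q\<close> is \<open>q\<close> or 0 according to whether \<open>q\<close> divides the
  index. Its term \<open>j = 0\<close> is split off.\<close>

lemma index_free_decomp:
  assumes "coprime m p" "q > 0"
  shows   "complex_of_real (index_free p g q m)
             = of_real (1 - 1 / real q) + index_free_osc p g q m"
proof -
  define x where "x = cis (2 * pi / real q) ^ ind m"
  have xq: "x ^ q = 1"
    unfolding x_def power_mult[symmetric] using assms by (simp add: cis_root_power_eq_1_iff)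
  have x1: "x = 1 \<longleftrightarrow> q dvd ind m"
    unfolding x_def using assms by (simp add: cis_root_power_eq_1_iff)
  have osc: "index_free_osc p g q m = - (1 / of_nat q) * (\<Sum>j = 1..<q. x ^ j)"
    using assms by (simp add: index_free_osc_def power_residue_character_def x_def
        power_mult[symmetric] mult.commute sum_distrib_left)
  have split: "(\<Sum>j<q. x ^ j) = 1 + (\<Sum>j = 1..<q. x ^ j)"
    using assms by (simp add: lessThan_atLeast0 sum.atLeast_Suc_lessThan)
  have "(\<Sum>j<q. x ^ j) = (if q dvd ind m then of_nat q else 0)"
    using xq x1 by (simp add: sum_gp_strict)
  then have "(\<Sum>j = 1..<q. x ^ j) = (if q dvd ind m then of_nat q else 0) - 1"
    using split by (simp add: algebra_simps)
  then show ?thesis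
    unfolding osc using assms by (cases "q dvd ind m") (simp_all add: index_free_def right_diff_distrib)
qed

end

section \<open>Subset expansions and error terms for sums of freeness indicators\<close>

text \<open>Half of the subsets contain \<open>a\<close>, so the average weight is
  \<open>3 / 4 * C\<close>. With \<open>a = 2\<close> this measures the gain from even
  characters.\<close>

lemma sum_Pow_member_weight:
  assumes "finite Q" "a \<in> Q"
  shows   "(\<Sum>T\<in>Pow Q. if a \<in> T then C else C / 2) = 3 / 4 * 2 ^ card Q * (C :: real)"
proof -
  \<comment> \<open>The weight of \<open>T\<close> is written as a product over \<open>Q\<close> in
    which only an omitted \<open>a\<close> contributes a factor 1/2, so the subset sum
    factors.\<close>
  have "(\<Sum>T\<in>Pow Q. (\<Prod>x\<in>T. 1 :: real) * (\<Prod>x\<in>Q - T. if x = a then 1 / 2 else 1))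
          = (\<Prod>x\<in>Q. 1 + (if x = a then 1 / 2 else 1))"
    by (rule prod_add[OF assms(1), symmetric])
  also have "\<dots> = 3 / 2 * (\<Prod>x\<in>Q - {a}. 1 + (if x = a then 1 / 2 else 1 :: real))"
    using assms by (simp add: prod.remove[of Q a])
  also have "(\<Prod>x\<in>Q - {a}. 1 + (if x = a then 1 / 2 else 1 :: real)) = (\<Prod>x\<in>Q - {a}. 2)"
    by (intro prod.cong) auto
  also have "\<dots> = 2 ^ (card Q - 1)"
    using assms by simp
  also have "(2::real) ^ card Q = 2 * 2 ^ (card Q - 1)"
    using assms card_gt_0_iff[of Q] by (metis Suc_diff_1 empty_iff power_Suc)
  then have "3 / 2 * 2 ^ (card Q - 1) = 3 / 4 * (2::real) ^ card Q" by simp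
  finally have *: "(\<Sum>T\<in>Pow Q. (\<Prod>x\<in>T. 1 :: real) * (\<Prod>x\<in>Q - T. if x = a then 1 / 2 else 1))
                     = 3 / 4 * 2 ^ card Q" .
  have "(\<Sum>T\<in>Pow Q. if a \<in> T then C else C / 2)
          = (\<Sum>T\<in>Pow Q. ((\<Prod>x\<in>T. 1 :: real) * (\<Prod>x\<in>Q - T. if x = a then 1 / 2 else 1)) * C)"
  proof (intro sum.cong refl)
    fix T assume "T \<in> Pow Q"
    then show "(if a \<in> T then C else C / 2)
      = ((\<Prod>x\<in>T. 1 :: real) * (\<Prod>x\<in>Q - T. if x = a then 1 / 2 else 1)) * C"
      using assms by (simp add: prod.delta)
  qed
  then show ?thesis
    by (simp only: sum_distrib_right[symmetric] *)
qed

locale primroot_char_bound = prime_primroot +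
  fixes C :: real
  assumes char_bound: "\<And>chi N H. dirichlet_character p chi \<Longrightarrow> \<not> principal_character p chi \<Longrightarrow>
        1 \<le> H \<Longrightarrow> H < p \<Longrightarrow> norm (\<Sum>m = N + 1..N + H. chi m) \<le> C"
begin

abbreviation "free \<equiv> index_free p g"
abbreviation "osc \<equiv> index_free_osc p g"

text \<open>For a set \<open>T\<close> of primes dividing \<open>p - 1\<close>, the proportion of
  units modulo \<open>p\<close> that are free of every prime in \<open>T\<close>.\<close>

abbreviation "dens T \<equiv> (\<Prod>q\<in>T. 1 - 1 / real q)"

lemma prime_factorD:
  assumes "q \<in> prime_factors (p - 1)"
  shows   "prime q" "q dvd p - 1" "q > 0"
  using assms prime_gt_0_nat by (auto simp: prime_factors_dvd)

lemma dens_pos: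
  assumes "T \<subseteq> prime_factors (p - 1)"
  shows   "0 < dens T"
proof (intro prod_pos ballI)
  fix q assume "q \<in> T"
  then have "q > 1" using assms prime_factorD(1) prime_gt_1_nat by blast
  then show "0 < 1 - 1 / real q" by simp
qed

lemmas dens_nonneg = less_imp_le[OF dens_pos]

text \<open>If 2 is not in \<open>T\<close>, all factors have odd order, so the product is an even
  character and the halved bound applies.\<close>

lemma character_product_bound:
  assumes T: "T \<noteq> {}" "T \<subseteq> prime_factors (p - 1)" and J: "\<And>q. q \<in> T \<Longrightarrow> J q \<in> {1..<q}"
    and H: "1 \<le> H" "H < p"
  shows   "norm (\<Sum>m = 1..H. \<Prod>q\<in>T. prc q (J q) m) \<le> (if 2 \<in> T then C else C / 2)"
proof -
  have fin: "finite T" using T(2) finite_subset by blast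
  have chr: "dirichlet_character p (\<lambda>m. \<Prod>q\<in>T. prc q (J q) m)"
    using T prime_factorD by (intro prod_power_residue_character_is_character fin) blast+
  have np: "\<not> principal_character p (\<lambda>m. \<Prod>q\<in>T. prc q (J q) m)"
    using T prime_factorD J by (intro prod_power_residue_character_nonprincipal fin) blast+
  show ?thesis
  proof (cases "2 \<in> T")
    case True
    then show ?thesis
      using char_bound[OF chr np H, of 0] by simp
  next
    case False
    have "(\<Prod>q\<in>T. prc q (J q) (p - 1)) = 1"
    proof (intro prod.neutral ballI)
      fix q assume q: "q \<in> T"
      then have q': "prime q" "q dvd p - 1" "q > 0" using T prime_factorD by blast+
      moreover have "q \<noteq> 2" using q False by auto
      ultimately have "odd q"
        using prime_odd_nat[of q] prime_ge_2_nat[of q] by linarith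
      then show "prc q (J q) (p - 1) = 1"
        using q' by (intro power_residue_character_minus_1)
    qed
    then show ?thesis
      using even_character_sum_bound[OF chr np _ char_bound[OF chr np] p_gt_1 H(2)] False
      by simp
  qed
qed

text \<open>Expanding gives one character for each choice \<open>J\<close> of exponents: there are
  as many as the product of the \<open>q - 1\<close>, each weighted by the product of the
  \<open>1 / q\<close>, and the total weight is exactly \<open>dens T\<close>.\<close>

lemma osc_product_bound:
  assumes T: "T \<noteq> {}" "T \<subseteq> prime_factors (p - 1)" and H: "1 \<le> H" "H < p"
  shows   "norm (\<Sum>m = 1..H. \<Prod>q\<in>T. osc q m) \<le> dens T * (if 2 \<in> T then C else C / 2)"
proof -
  let ?D = "if 2 \<in> T then C else C / 2"
  let ?P = "PiE T (\<lambda>q. {1..<q})"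
  have fin: "finite T" using T(2) finite_subset by blast
  have "(\<Sum>m = 1..H. \<Prod>q\<in>T. osc q m)
      = (\<Sum>m = 1..H. \<Sum>J\<in>?P. \<Prod>q\<in>T. - (1 / of_nat q) * prc q (J q) m)"
    unfolding index_free_osc_def by (subst prod_sum_PiE) (auto intro: fin)
  also have "\<dots> = (\<Sum>J\<in>?P. \<Sum>m = 1..H. \<Prod>q\<in>T. - (1 / of_nat q) * prc q (J q) m)"
    by (rule sum.swap)
  also have "\<dots> = (\<Sum>J\<in>?P. (\<Prod>q\<in>T. - (1 / of_nat q)) * (\<Sum>m = 1..H. \<Prod>q\<in>T. prc q (J q) m))"
    unfolding prod.distrib sum_distrib_left ..
  finally have "norm (\<Sum>m = 1..H. \<Prod>q\<in>T. osc q m)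
      \<le> (\<Sum>J\<in>?P. norm ((\<Prod>q\<in>T. - (1 / of_nat q)) * (\<Sum>m = 1..H. \<Prod>q\<in>T. prc q (J q) m)))"
    by (simp only: norm_sum)
  also have "\<dots> \<le> (\<Sum>J\<in>?P. (\<Prod>q\<in>T. 1 / real q) * ?D)"
  proof (intro sum_mono)
    fix J assume "J \<in> ?P"
    then have J: "\<And>q. q \<in> T \<Longrightarrow> J q \<in> {1..<q}" by (auto simp: PiE_iff)
    have "norm (\<Prod>q\<in>T. - (1 / of_nat q :: complex)) = (\<Prod>q\<in>T. 1 / real q)"
      unfolding prod_norm[symmetric] by (simp add: norm_divide)
    then show "norm ((\<Prod>q\<in>T. - (1 / of_nat q)) * (\<Sum>m = 1..H. \<Prod>q\<in>T. prc q (J q) m))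
               \<le> (\<Prod>q\<in>T. 1 / real q) * ?D"
      unfolding norm_mult using character_product_bound[OF T J H]
      by (metis mult_left_mono norm_ge_zero)
  qed
  also have "\<dots> = real (card ?P) * (\<Prod>q\<in>T. 1 / real q) * ?D"
    by simp
  also have "real (card ?P) * (\<Prod>q\<in>T. 1 / real q) = (\<Prod>q\<in>T. real (q - 1) * (1 / real q))"
    unfolding prod.distrib using fin by (simp add: card_PiE)
  also have "\<dots> = dens T"
    using T(2) prime_factorD(3) by (intro prod.cong refl) (force simp: of_nat_diff field_simps)
  finally show ?thesis .
qed

text \<open>\<open>T\<close> is the set of primes at which the oscillating part is taken, the mean
  being taken at the others.\<close>

lemma prod_free_expand:
  assumes Q: "Q \<subseteq> prime_factors (p - 1)" and m: "m \<in> {1..H}" "H < p"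
  shows   "complex_of_real (\<Prod>q\<in>Q. free q m)
             = (\<Sum>T\<in>Pow Q. (\<Prod>q\<in>T. osc q m) * of_real (dens (Q - T)))"
proof -
  have fin: "finite Q" using Q finite_subset by blast
  have "complex_of_real (\<Prod>q\<in>Q. free q m) = (\<Prod>q\<in>Q. osc q m + of_real (1 - 1 / real q))"
    unfolding of_real_prod using Q m prime_factorD(3) coprime_less
    by (intro prod.cong refl) (subst index_free_decomp, auto)
  also have "\<dots> = (\<Sum>T\<in>Pow Q. (\<Prod>q\<in>T. osc q m) * of_real (dens (Q - T)))"
    by (subst prod_add[OF fin]) simp
  finally show ?thesis .
qed

text \<open>The empty subset gives the main term. Each of the other \<open>2 ^ card Q - 1\<close>
  subsets contributes at most \<open>dens T * dens (Q - T) * C = dens Q * C\<close>.\<close>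

lemma sum_free_product_bound:
  assumes Q: "Q \<subseteq> prime_factors (p - 1)" and H: "1 \<le> H" "H < p" and "0 \<le> C"
  shows   "\<bar>(\<Sum>m = 1..H. \<Prod>q\<in>Q. free q m) - dens Q * real H\<bar>
             \<le> dens Q * (2 ^ card Q - 1) * C"
proof -
  have fin: "finite Q" using Q finite_subset by blast
  have "complex_of_real (\<Sum>m = 1..H. \<Prod>q\<in>Q. free q m)
      = (\<Sum>m = 1..H. \<Sum>T\<in>Pow Q. (\<Prod>q\<in>T. osc q m) * of_real (dens (Q - T)))"
    unfolding of_real_sum by (intro sum.cong refl prod_free_expand[OF Q]) (use H in auto)
  also have "\<dots> = (\<Sum>T\<in>Pow Q. \<Sum>m = 1..H. (\<Prod>q\<in>T. osc q m) * of_real (dens (Q - T)))"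
    by (rule sum.swap)
  also have "\<dots> = of_real (dens Q * real H)
      + (\<Sum>T\<in>Pow Q - {{}}. (\<Sum>m = 1..H. \<Prod>q\<in>T. osc q m) * of_real (dens (Q - T)))"
    unfolding sum_distrib_right using fin by (subst sum.remove[of _ "{}"]) auto
  finally have "complex_of_real ((\<Sum>m = 1..H. \<Prod>q\<in>Q. free q m) - dens Q * real H)
      = (\<Sum>T\<in>Pow Q - {{}}. (\<Sum>m = 1..H. \<Prod>q\<in>T. osc q m) * of_real (dens (Q - T)))"
    unfolding of_real_diff by (simp only: add_diff_cancel_left')
  from arg_cong[OF this, of norm]
  have "\<bar>(\<Sum>m = 1..H. \<Prod>q\<in>Q. free q m) - dens Q * real H\<bar>
      = norm (\<Sum>T\<in>Pow Q - {{}}. (\<Sum>m = 1..H. \<Prod>q\<in>T. osc q m) * of_real (dens (Q - T)))"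
    by (simp only: norm_of_real)
  also have "\<dots> \<le> (\<Sum>T\<in>Pow Q - {{}}. dens Q * C)"
  proof (rule sum_norm_le)
    fix T assume T: "T \<in> Pow Q - {{}}"
    have sub: "T \<subseteq> prime_factors (p - 1)" "Q - T \<subseteq> prime_factors (p - 1)" using T Q by auto
    have "norm (\<Sum>m = 1..H. \<Prod>q\<in>T. osc q m) \<le> dens T * (if 2 \<in> T then C else C / 2)"
      using T sub H by (intro osc_product_bound) auto
    also have "\<dots> \<le> dens T * C"
      using \<open>0 \<le> C\<close> dens_nonneg[OF sub(1)] by (intro mult_left_mono) auto
    finally have "norm ((\<Sum>m = 1..H. \<Prod>q\<in>T. osc q m) * of_real (dens (Q - T)))
        \<le> dens T * C * dens (Q - T)"
      unfolding norm_mult norm_of_real abs_of_nonneg[OF dens_nonneg[OF sub(2)]]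
      by (rule mult_right_mono[OF _ dens_nonneg[OF sub(2)]])
    also have "\<dots> = dens Q * C"
      using prod.subset_diff[of T Q "\<lambda>q. 1 - 1 / real q"] T fin by auto
    finally show "norm ((\<Sum>m = 1..H. \<Prod>q\<in>T. osc q m) * of_real (dens (Q - T)))
        \<le> dens Q * C" .
  qed
  also have "\<dots> = dens Q * (2 ^ card Q - 1) * C"
    using fin by (simp add: card_Diff_singleton card_Pow of_nat_diff)
  finally show ?thesis .
qed

text \<open>Subtracting the mean of \<open>free r\<close> leaves only subsets containing
  \<open>r\<close>, so there is no main term. Since \<open>r \<noteq> 2\<close>, the subsets of
  \<open>Q\<close> without 2 yield even characters and cost only \<open>C / 2\<close>, whence the
  factor 3/4.\<close>

lemma sum_free_product_insert_bound:
  assumes Q: "Q \<subseteq> prime_factors (p - 1)" "2 \<in> Q" and r: "r \<in> prime_factors (p - 1)" "r \<notin> Q"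
    and H: "1 \<le> H" "H < p"
  shows   "\<bar>(\<Sum>m = 1..H. (\<Prod>q\<in>Q. free q m) * (free r m - (1 - 1 / real r)))\<bar>
             \<le> dens Q * (1 - 1 / real r) * (3 / 4 * 2 ^ card Q * C)"
proof -
  have fin: "finite Q" using Q finite_subset by blast
  have "r \<noteq> 2" using r Q by auto
  have "complex_of_real (\<Sum>m = 1..H. (\<Prod>q\<in>Q. free q m) * (free r m - (1 - 1 / real r)))
      = (\<Sum>m = 1..H. (\<Sum>T\<in>Pow Q. (\<Prod>q\<in>T. osc q m) * of_real (dens (Q - T))) * osc r m)"
    unfolding of_real_sum
  proof (intro sum.cong refl)
    fix m assume m: "m \<in> {1..H}"
    then have "complex_of_real (free r m - (1 - 1 / real r)) = osc r m"
      using coprime_less[of m] H prime_factorD[OF r(1)] index_free_decomp[of m r] by simp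
    then show "complex_of_real ((\<Prod>q\<in>Q. free q m) * (free r m - (1 - 1 / real r)))
      = (\<Sum>T\<in>Pow Q. (\<Prod>q\<in>T. osc q m) * of_real (dens (Q - T))) * osc r m"
      by (simp only: of_real_mult prod_free_expand[OF Q(1) m H(2)])
  qed
  also have "\<dots> = (\<Sum>m = 1..H. \<Sum>T\<in>Pow Q. (\<Prod>q\<in>insert r T. osc q m) * of_real (dens (Q - T)))"
    unfolding sum_distrib_right
  proof (intro sum.cong refl)
    fix m T assume T: "T \<in> Pow Q"
    then have "r \<notin> T" "finite T" using r(2) fin finite_subset by auto
    then show "(\<Prod>q\<in>T. osc q m) * of_real (dens (Q - T)) * osc r m
        = (\<Prod>q\<in>insert r T. osc q m) * of_real (dens (Q - T))"
      by (simp add: mult_ac)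
  qed
  also have "\<dots> = (\<Sum>T\<in>Pow Q. (\<Sum>m = 1..H. \<Prod>q\<in>insert r T. osc q m) * of_real (dens (Q - T)))"
    unfolding sum_distrib_right by (rule sum.swap)
  finally have "complex_of_real (\<Sum>m = 1..H. (\<Prod>q\<in>Q. free q m) * (free r m - (1 - 1 / real r)))
      = (\<Sum>T\<in>Pow Q. (\<Sum>m = 1..H. \<Prod>q\<in>insert r T. osc q m) * of_real (dens (Q - T)))" .
  from arg_cong[OF this, of norm]
  have "\<bar>(\<Sum>m = 1..H. (\<Prod>q\<in>Q. free q m) * (free r m - (1 - 1 / real r)))\<bar>
      = norm (\<Sum>T\<in>Pow Q. (\<Sum>m = 1..H. \<Prod>q\<in>insert r T. osc q m) * of_real (dens (Q - T)))"
    by (simp only: norm_of_real)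
  also have "\<dots> \<le> (\<Sum>T\<in>Pow Q. dens Q * (1 - 1 / real r) * (if 2 \<in> T then C else C / 2))"
  proof (rule sum_norm_le)
    fix T assume T: "T \<in> Pow Q"
    have sub: "insert r T \<subseteq> prime_factors (p - 1)" "Q - T \<subseteq> prime_factors (p - 1)"
      using T Q r by auto
    have rT: "r \<notin> T" "finite T" using T r(2) fin finite_subset by auto
    have "norm (\<Sum>m = 1..H. \<Prod>q\<in>insert r T. osc q m)
        \<le> dens (insert r T) * (if 2 \<in> insert r T then C else C / 2)"
      using sub H by (intro osc_product_bound) auto
    then have "norm ((\<Sum>m = 1..H. \<Prod>q\<in>insert r T. osc q m) * of_real (dens (Q - T)))
        \<le> dens (insert r T) * (if 2 \<in> insert r T then C else C / 2) * dens (Q - T)"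
      unfolding norm_mult norm_of_real abs_of_nonneg[OF dens_nonneg[OF sub(2)]]
      by (rule mult_right_mono[OF _ dens_nonneg[OF sub(2)]])
    also have "\<dots> = dens Q * (1 - 1 / real r) * (if 2 \<in> T then C else C / 2)"
    proof -
      have "dens Q = dens (Q - T) * dens T"
        using prod.subset_diff[of T Q "\<lambda>q. 1 - 1 / real q"] T fin by auto
      moreover have "dens (insert r T) = (1 - 1 / real r) * dens T"
        using rT by simp
      moreover have "2 \<in> insert r T \<longleftrightarrow> 2 \<in> T" using \<open>r \<noteq> 2\<close> by auto
      ultimately show ?thesis by (simp only: mult_ac)
    qed
    finally show "norm ((\<Sum>m = 1..H. \<Prod>q\<in>insert r T. osc q m) * of_real (dens (Q - T)))
        \<le> dens Q * (1 - 1 / real r) * (if 2 \<in> T then C else C / 2)" .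
  qed
  also have "\<dots> = dens Q * (1 - 1 / real r) * (3 / 4 * 2 ^ card Q * C)"
    by (simp only: sum_distrib_left[symmetric] sum_Pow_member_weight[OF fin Q(2)])
  finally show ?thesis .
qed

text \<open>A character of odd order \<open>r\<close> has sum 1 over the interval of length one,
  where the bound is \<open>C / 2\<close>.\<close>

lemma two_le_bound:
  assumes r: "r \<in> prime_factors (p - 1)" "r \<noteq> 2"
  shows   "2 \<le> C"
proof -
  have "prime r" using prime_factorD r by blast
  then have "norm (\<Sum>m = 1..1. \<Prod>q\<in>{r}. prc q 1 m) \<le> C / 2"
    using character_product_bound[of "{r}" "\<lambda>_. 1" 1] r p_gt_1 prime_gt_1_nat[of r] by auto
  moreover have "prc r 1 1 = 1"
    using dirichlet_character_1 power_residue_character_is_character prime_factorD(2)[OF r(1)]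
    by blast
  ultimately show ?thesis by simp
qed

lemma residue_primroot_if_free:
  assumes "m \<in> {1..<p}" "\<And>q. q \<in> prime_factors (p - 1) \<Longrightarrow> free q m \<noteq> 0"
  shows   "residue_primroot p m"
proof (rule residue_primroot_if_index_coprime)
  show "coprime m p" using assms(1) coprime_less by auto
  show "coprime (ind m) (p - 1)"
  proof (rule ccontr)
    assume "\<not> coprime (ind m) (p - 1)"
    then have "gcd (ind m) (p - 1) \<noteq> 1" unfolding coprime_iff_gcd_eq_1 .
    then obtain q where "prime q" "q dvd gcd (ind m) (p - 1)"
      using prime_factor_nat by blast
    then have q: "prime q" "q dvd ind m" "q dvd p - 1"
      by (simp_all only: gcd_greatest_iff)
    then have "q \<in> prime_factors (p - 1)"
      using p_gt_1 by (auto simp: prime_factors_dvd)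
    then show False
      using assms(2)[of q] q(2) by (simp add: index_free_def)
  qed
qed

section \<open>The sieve over the primes in \<open>R\<close>\<close>

text \<open>Weights supported on elements free of \<open>Q\<close> are sieved by \<open>R\<close>.
  The hypothesis \<open>large\<close> has \<open>real H + 1\<close> to absorb the rounding of a real
  threshold to an integer.\<close>

lemma small_primroot_exists:
  assumes QR: "Q \<union> R = prime_factors (p - 1)" "Q \<inter> R = {}" and "2 \<in> Q" "R \<noteq> {}"
    and H: "1 \<le> H" "H < p"
    and delta: "\<delta> = 1 - (\<Sum>r\<in>R. 1 / real r)" "\<delta> > 0"
    and large: "real H + 1 > C * (2 ^ card Q * ((real (card R) - 1) / \<delta> + 2) - 1)"
  shows   "\<exists>m\<in>{1..H}. residue_primroot p m"
proof (rule ccontr)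
  assume none: "\<not> (\<exists>m\<in>{1..H}. residue_primroot p m)"
  define F where "F m = (\<Prod>q\<in>Q. free q m)" for m
  define K :: real where "K = 2 ^ card Q"
  define s where "s = real (card R)"
  define \<theta> where "\<theta> = dens Q"
  have fin: "finite Q" "finite R"
    using QR(1) finite_subset[of _ "prime_factors (p - 1)"] by auto
  have Qsub: "Q \<subseteq> prime_factors (p - 1)" and Rsub: "R \<subseteq> prime_factors (p - 1)"
    using QR by auto
  have s1: "s \<ge> 1"
    using fin(2) \<open>R \<noteq> {}\<close> card_gt_0_iff[of R] by (simp add: s_def Suc_le_eq)
  have "card Q \<ge> 1" using fin(1) \<open>2 \<in> Q\<close> card_gt_0_iff[of Q] by (auto simp: Suc_le_eq)
  then have K2: "K \<ge> 2" using power_increasing[of 1 "card Q" "2::real"] by (simp add: K_def)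
  obtain r where r: "r \<in> R" using \<open>R \<noteq> {}\<close> by auto
  have C2: "C \<ge> 2"
    using r QR \<open>2 \<in> Q\<close> by (intro two_le_bound[of r]) auto
  have \<theta>0: "\<theta> > 0"
    unfolding \<theta>_def by (rule dens_pos[OF Qsub])
  \<comment> \<open>This total of the means, divided by \<delta>, is
    \<open>(s - 1) / \<delta> + 1\<close>; the remaining 1 in \<Delta> comes from the error of the
    main term.\<close>
  have sumR: "(\<Sum>r\<in>R. 1 - 1 / real r) = s - 1 + \<delta>"
    using delta(1) by (simp add: sum_subtractf s_def)
  have F_nonneg: "F m \<ge> 0" for m
    unfolding F_def by (intro prod_nonneg) (simp add: index_free_def)

  \<comment> \<open>The product over \<open>R\<close> is at least one minus the number of failures,
    and without a primitive root the product over all primes is zero.\<close>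
  have pointwise: "F m * (1 - (\<Sum>r\<in>R. 1 - free r m)) \<le> 0" if "m \<in> {1..H}" for m
  proof -
    have "1 - (\<Sum>r\<in>R. 1 - free r m) \<le> (\<Prod>r\<in>R. 1 - (1 - free r m))"
      by (intro Weierstrass_prod_ineq) (simp add: index_free_def)
    then have "F m * (1 - (\<Sum>r\<in>R. 1 - free r m)) \<le> F m * (\<Prod>r\<in>R. free r m)"
      using F_nonneg by (intro mult_left_mono) simp_all
    also have "\<dots> = (\<Prod>q\<in>prime_factors (p - 1). free q m)"
      unfolding F_def QR(1)[symmetric] using fin QR(2) by (simp add: prod.union_disjoint)
    also have "\<dots> = 0"
      using residue_primroot_if_free[of m] none that H by auto
    finally show ?thesis .
  qed
  \<comment> \<open>Centring each indicator at its mean isolates \<delta> as the coefficient of the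
    main sum.\<close>
  have "1 - (\<Sum>r\<in>R. 1 - free r m) = \<delta> + (\<Sum>r\<in>R. free r m - (1 - 1 / real r))" for m
    using delta(1) by (simp add: sum_subtractf)
  then have "F m * (1 - (\<Sum>r\<in>R. 1 - free r m))
      = \<delta> * F m + (\<Sum>r\<in>R. F m * (free r m - (1 - 1 / real r)))" for m
    by (simp only: distrib_left sum_distrib_left mult.commute)
  then have "\<delta> * (\<Sum>m = 1..H. F m) + (\<Sum>m = 1..H. \<Sum>r\<in>R. F m * (free r m - (1 - 1 / real r)))
      = (\<Sum>m = 1..H. F m * (1 - (\<Sum>r\<in>R. 1 - free r m)))"
    by (simp add: sum.distrib sum_distrib_left)
  also have "\<dots> \<le> 0"
    using pointwise by (intro sum_nonpos) auto
  finally have sieve: "\<delta> * (\<Sum>m = 1..H. F m)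
      \<le> (\<Sum>r\<in>R. - (\<Sum>m = 1..H. F m * (free r m - (1 - 1 / real r))))"
    by (subst (asm) sum.swap) (simp add: sum_negf)
  also have "\<dots> \<le> (\<Sum>r\<in>R. \<theta> * (1 - 1 / real r) * (3 / 4 * K * C))"
  proof (intro sum_mono)
    fix r assume "r \<in> R"
    then show "- (\<Sum>m = 1..H. F m * (free r m - (1 - 1 / real r)))
        \<le> \<theta> * (1 - 1 / real r) * (3 / 4 * K * C)"
      using sum_free_product_insert_bound[OF Qsub \<open>2 \<in> Q\<close> _ _ H, of r] Rsub QR(2)
      unfolding F_def \<theta>_def K_def by force
  qed
  also have "\<dots> = \<theta> * (s - 1 + \<delta>) * (3 / 4 * K * C)"
    unfolding sumR[symmetric] sum_distrib_left sum_distrib_right ..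
  finally have upper: "\<delta> * (\<Sum>m = 1..H. F m) \<le> \<theta> * ((s - 1 + \<delta>) * (3 / 4 * K * C))"
    by (simp only: mult_ac)
  have "\<theta> * (real H - (K - 1) * C) \<le> (\<Sum>m = 1..H. F m)"
    using sum_free_product_bound[OF Qsub H] C2
    unfolding F_def[symmetric] \<theta>_def[symmetric] K_def[symmetric] by (simp add: algebra_simps abs_le_iff)
  then have "\<delta> * (\<theta> * (real H - (K - 1) * C)) \<le> \<delta> * (\<Sum>m = 1..H. F m)"
    using delta(2) by (intro mult_left_mono) auto
  with upper have "\<theta> * (\<delta> * (real H - (K - 1) * C)) \<le> \<theta> * ((s - 1 + \<delta>) * (3 / 4 * K * C))"
    by (simp add: mult.left_commute)
  then have le: "\<delta> * (real H - (K - 1) * C) \<le> (s - 1 + \<delta>) * (3 / 4 * K * C)"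
    using \<theta>0 by (simp only: mult_le_cancel_left_pos)
  have "\<delta> * (C * (K * ((s - 1) / \<delta> + 2) - 1)) < \<delta> * (real H + 1)"
    using large delta(2) unfolding K_def s_def by (simp only: mult_less_cancel_left_pos)
  moreover have "\<delta> * (C * (K * ((s - 1) / \<delta> + 2) - 1)) = C * (K * (s - 1 + 2 * \<delta>) - \<delta>)"
    using delta(2) by (simp add: field_simps)
  ultimately have "C * (K * (s - 1 + 2 * \<delta>) - \<delta>) < \<delta> * (real H + 1)" by simp
  \<comment> \<open>All other terms cancel: the quarter saved by even characters stands against the
    \<delta> caused by the extra 1 in \<open>large\<close>.\<close>
  with le have "(s - 1 + \<delta>) * (K * C) / 4 < \<delta>"
    by (simp add: algebra_simps)
  \<comment> \<open>Here \<open>K \<ge> 2\<close> because 2 is in \<open>Q\<close>, and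
    \<open>C \<ge> 2\<close>, so \<open>K * C\<close> is at least 4, just enough for a
    contradiction.\<close>
  moreover have "\<delta> * 4 \<le> (s - 1 + \<delta>) * (K * C)"
    using s1 delta(2) K2 C2 mult_mono[of 2 K 2 C] by (intro mult_mono) auto
  ultimately show False by simp
qed

end

section \<open>Primitive roots below \<open>p powr \<alpha>\<close>\<close>

theorem theorem3:
  fixes p e :: nat and \<alpha> c :: real
  assumes p_prime: "prime p" and p_odd: "odd p"
    and \<alpha>_pos: "0 < \<alpha>" and \<alpha>_lt1: "\<alpha> < 1"
    and c_pos: "c > 0"
    and char_bound: "\<And>chi N H. dirichlet_character p chi \<Longrightarrow> \<not> principal_character p chi \<Longrightarrow>
        1 \<le> H \<Longrightarrow> H < p \<Longrightarrow>
        norm (\<Sum>m = N + 1..N + H. chi m) \<le> c * sqrt (real p) * ln (real p)"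
    and e_even: "even e" and e_dvd: "e dvd p - 1"
    and s_ge1: "1 \<le> card {q. prime q \<and> q dvd p - 1 \<and> \<not> q dvd e}"
    and s_le_n: "card {q. prime q \<and> q dvd p - 1 \<and> \<not> q dvd e} \<le> omega (p - 1)"
    and delta_pos: "1 - (\<Sum>q\<in>{q. prime q \<and> q dvd p - 1 \<and> \<not> q dvd e}. 1 / real q) > 0"
    and main: "real p powr (\<alpha> - 1/2) / ln (real p) >
        c * (2 ^ (omega (p - 1) - card {q. prime q \<and> q dvd p - 1 \<and> \<not> q dvd e})
             * ((real (card {q. prime q \<and> q dvd p - 1 \<and> \<not> q dvd e}) - 1)
                 / (1 - (\<Sum>q\<in>{q. prime q \<and> q dvd p - 1 \<and> \<not> q dvd e}. 1 / real q)) + 2)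
             - 1)"
  shows "\<exists>g::nat. residue_primroot p g \<and> real g < real p powr \<alpha>"
proof -
  define R where "R = {q. prime q \<and> q dvd p - 1 \<and> \<not> q dvd e}"
  define Q where "Q = prime_factors (p - 1) - R"
  define C where "C = c * sqrt (real p) * ln (real p)"
  define \<delta> where "\<delta> = 1 - (\<Sum>q\<in>R. 1 / real q)"
  \<comment> \<open>The largest integer strictly below \<open>p powr \<alpha>\<close>; the floor
    would be too large by one when that power is an integer.\<close>
  define H where "H = nat (\<lceil>real p powr \<alpha>\<rceil> - 1)"
  have p1: "p > 1" using p_prime prime_gt_1_nat by blast
  \<comment> \<open>This primitive root may have any size; it only serves as the base of the
    index.\<close>
  obtain g where "residue_primroot p g"
    using prime_primitive_root_exists[of p] p_prime p1 by auto
  then interpret primroot_char_bound p g C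
    using p_prime char_bound unfolding C_def by unfold_locales
  have Rsub: "R \<subseteq> prime_factors (p - 1)"
    using p1 by (auto simp: R_def prime_factors_dvd)
  have card_Q: "card Q = omega (p - 1) - card R"
    using Rsub finite_subset[OF Rsub] by (simp add: Q_def omega_def card_Diff_subset)
  have "2 dvd p - 1" using p_odd by simp
  then have Q2: "2 \<in> Q"
    using e_even p1 by (auto simp: Q_def R_def prime_factors_dvd)
  have R_ne: "R \<noteq> {}" using s_ge1 unfolding R_def[symmetric] by auto

  have x1: "real p powr \<alpha> > 1" using p1 \<alpha>_pos by simp
  have xp: "real p powr \<alpha> < real p"
    using p1 \<alpha>_lt1 powr_less_cancel_iff[of "real p" \<alpha> 1] by simp
  have H: "1 \<le> H" "real H < real p powr \<alpha>" "real p powr \<alpha> \<le> real H + 1"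
    using x1 unfolding H_def by linarith+
  then have "H < p" using xp by linarith

  have lnp: "ln (real p) > 0" using p1 by simp
  have "real p powr (\<alpha> - 1/2) * sqrt (real p) = real p powr \<alpha>"
    using p1 by (simp add: powr_half_sqrt[symmetric] powr_add[symmetric])
  then have x_eq: "real p powr (\<alpha> - 1/2) / ln (real p) * (sqrt (real p) * ln (real p)) = real p powr \<alpha>"
    using lnp by (simp add: field_simps)
  \<comment> \<open>Multiplying by \<open>sqrt p * ln p\<close> turns the left side of
    \<open>main\<close> into \<open>p powr \<alpha>\<close> and the constant \<open>c\<close> into
    \<open>C\<close>.\<close>
  have "c * (2 ^ card Q * ((real (card R) - 1) / \<delta> + 2) - 1) * (sqrt (real p) * ln (real p))
      < real p powr (\<alpha> - 1/2) / ln (real p) * (sqrt (real p) * ln (real p))"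
    using main lnp p1 unfolding R_def[symmetric] \<delta>_def[symmetric] card_Q[symmetric]
    by (intro mult_strict_right_mono) auto
  then have "C * (2 ^ card Q * ((real (card R) - 1) / \<delta> + 2) - 1) < real p powr \<alpha>"
    unfolding x_eq C_def by (simp only: mult_ac)
  then have "C * (2 ^ card Q * ((real (card R) - 1) / \<delta> + 2) - 1) < real H + 1"
    using H(3) by linarith
  moreover have "Q \<union> R = prime_factors (p - 1)" "Q \<inter> R = {}"
    using Rsub by (auto simp: Q_def)
  moreover have "\<delta> > 0"
    using delta_pos by (simp add: \<delta>_def R_def)
  ultimately obtain m where "m \<in> {1..H}" "residue_primroot p m"
    using small_primroot_exists[OF _ _ Q2 R_ne H(1) \<open>H < p\<close> \<delta>_def] by blast
  then show ?thesis using H(2) by force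
qed

end
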